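(* Let $\varphi\colon B_n\to\operatorname{PSL}_2\mathbb{Z}$ be a homomorphism. Then the following hold. \begin{enumerate} \item[(i)] If $n\geq5$, then $\varphi$ is cyclic. \item[(ii)] If $n=4$, then $\varphi$ factors through $R_*\colon B_4\twoheadrightarrow B_3$. \item[(iii)] If $n=3$ and $\varphi$ is non-cyclic, then $\varphi$ descends to an endomorphism of $\operatorname{PSL}_2\mathbb{Z}$ (i.e. $\varphi$ factors through the quotient map $B_3\twoheadrightarrow B_3/Z(B_3)\cong\operatorname{PSL}_2\mathbb{Z}$). \end{enumerate}
   Context: $B_n$ is the braid group on $n$ strands with Artin generators $\sigma_1,\dots,\sigma_{n-1}$. $R_*\colon B_4\to B_3$ is the surjective homomorphism $\sigma_1,\sigma_3\mapsto\sigma_1$, $\sigma_2\mapsto\sigma_2$. A homomorphism is cyclic if its image is a cyclic group. One has $B_3=\langle\alpha,\beta\mid\alpha^3=\beta^2\rangle$ with $\alpha=\sigma_1\sigma_2$, $\beta=\sigma_1\sigma_2\sigma_1$, its center is $Z(B_3)=\langle\alpha^3\rangle$, and $B_3/Z(B_3)\cong\operatorname{PSL}_2\mathbb{Z}$. *)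

theory Defs
  imports
    "HOL-Algebra.Coset"
    "HOL-Algebra.Elementary_Groups"
    "HOL-Analysis.Determinants"
begin

section \<open>Groups given by generators and relations\<close>

text \<open>
  A word is a list of letters: \<open>(s, True)\<close> stands for the generator \<open>s\<close> and \<open>(s, False)\<close>
  for its formal inverse.
\<close>

type_synonym 'a word = "('a \<times> bool) list"

inductive pres_eq :: "'a set \<Rightarrow> ('a word \<times> 'a word) set \<Rightarrow> 'a word \<Rightarrow> 'a word \<Rightarrow> bool"
  for S :: "'a set" and R :: "('a word \<times> 'a word) set"
where
  refl: "w \<in> lists (S \<times> UNIV) \<Longrightarrow> pres_eq S R w w"
| sym: "pres_eq S R v w \<Longrightarrow> pres_eq S R w v"
| trans: "pres_eq S R u v \<Longrightarrow> pres_eq S R v w \<Longrightarrow> pres_eq S R u w"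
| append: "pres_eq S R u u' \<Longrightarrow> pres_eq S R v v' \<Longrightarrow> pres_eq S R (u @ v) (u' @ v')"
| cancel: "s \<in> S \<Longrightarrow> pres_eq S R [(s, b), (s, \<not> b)] []"
| rel: "(u, v) \<in> R \<Longrightarrow> u \<in> lists (S \<times> UNIV) \<Longrightarrow> v \<in> lists (S \<times> UNIV) \<Longrightarrow> pres_eq S R u v"

definition pres_class :: "'a set \<Rightarrow> ('a word \<times> 'a word) set \<Rightarrow> 'a word \<Rightarrow> 'a word set" where
  "pres_class S R w = {v. pres_eq S R w v}"

definition presented_group :: "'a set \<Rightarrow> ('a word \<times> 'a word) set \<Rightarrow> 'a word set monoid" where
  "presented_group S R =
    \<lparr>carrier = lists (S \<times> UNIV) // {(v, w). pres_eq S R v w},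
     monoid.mult = (\<lambda>X Y. \<Union>u\<in>X. \<Union>v\<in>Y. pres_class S R (u @ v)),
     one = pres_class S R []\<rparr>"

lemma pres_eq_lists: "pres_eq S R v w \<Longrightarrow> v \<in> lists (S \<times> UNIV) \<and> w \<in> lists (S \<times> UNIV)"
  by (induction rule: pres_eq.induct) auto

lemma pres_class_eq:
  "pres_eq S R v w \<Longrightarrow> pres_class S R v = pres_class S R w"
  unfolding pres_class_def by (blast intro: pres_eq.sym pres_eq.trans)

lemma pres_class_eq_iff:
  assumes "v \<in> lists (S \<times> UNIV)"
  shows "pres_class S R v = pres_class S R w \<longleftrightarrow> pres_eq S R v w"
proof
  assume "pres_class S R v = pres_class S R w"
  with assms have "v \<in> pres_class S R w"
    by (auto simp: pres_class_def intro: pres_eq.refl)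
  then show "pres_eq S R v w"
    by (simp add: pres_class_def pres_eq.sym)
qed (rule pres_class_eq)

lemma carrier_presented_group:
  "carrier (presented_group S R) = pres_class S R ` lists (S \<times> UNIV)"
  by (auto simp: presented_group_def quotient_def pres_class_def)

lemma one_presented_group: "\<one>\<^bsub>presented_group S R\<^esub> = pres_class S R []"
  by (simp add: presented_group_def)

lemma mult_presented_group:
  assumes "u \<in> lists (S \<times> UNIV)" "v \<in> lists (S \<times> UNIV)"
  shows "pres_class S R u \<otimes>\<^bsub>presented_group S R\<^esub> pres_class S R v = pres_class S R (u @ v)"
proof -
  have "pres_class S R (u' @ v') = pres_class S R (u @ v)"
    if "u' \<in> pres_class S R u" "v' \<in> pres_class S R v" for u' v'
    using that by (intro pres_class_eq) (auto simp: pres_class_def intro: pres_eq.append pres_eq.sym)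
  moreover have "u \<in> pres_class S R u" "v \<in> pres_class S R v"
    using assms by (auto simp: pres_class_def intro: pres_eq.refl)
  ultimately have "(\<Union>u'\<in>pres_class S R u. \<Union>v'\<in>pres_class S R v. pres_class S R (u' @ v')) =
      pres_class S R (u @ v)"
    by blast
  then show ?thesis
    by (simp add: presented_group_def)
qed

lemma pres_eq_inverse_word:
  "w \<in> lists (S \<times> UNIV) \<Longrightarrow> pres_eq S R (rev (map (apsnd Not) w) @ w) []"
proof (induction w)
  case Nil
  then show ?case by (auto intro: pres_eq.refl)
next
  case (Cons a w)
  obtain s b where a: "a = (s, b)" by fastforce
  have s: "s \<in> S" and w: "w \<in> lists (S \<times> UNIV)"
    using Cons.prems a by auto
  let ?r = "rev (map (apsnd Not) w)"
  have r: "?r \<in> lists (S \<times> UNIV)"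
    using w by (induction w) auto
  have "pres_eq S R [(s, \<not> b), (s, b)] []"
    using pres_eq.cancel[OF s, of R "\<not> b"] by simp
  from pres_eq.append[OF pres_eq.refl[OF r] pres_eq.append[OF this pres_eq.refl[OF w]]]
  have "pres_eq S R (?r @ ([(s, \<not> b), (s, b)] @ w)) (?r @ ([] @ w))" .
  then have "pres_eq S R (rev (map (apsnd Not) (a # w)) @ a # w) (?r @ w)"
    by (simp add: a)
  from pres_eq.trans[OF this Cons.IH[OF w]] show ?case .
qed

lemma group_presented_group: "group (presented_group S R)"
proof (rule groupI)
  let ?G = "presented_group S R"
  show "\<one>\<^bsub>?G\<^esub> \<in> carrier ?G"
    by (simp add: one_presented_group carrier_presented_group)
  fix x assume "x \<in> carrier ?G"
  then obtain u where u: "u \<in> lists (S \<times> UNIV)" "x = pres_class S R u"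
    by (auto simp: carrier_presented_group)
  show "\<one>\<^bsub>?G\<^esub> \<otimes>\<^bsub>?G\<^esub> x = x"
    using u mult_presented_group[of "[]" S u R] by (simp add: one_presented_group)
  let ?r = "rev (map (apsnd Not) u)"
  have r: "?r \<in> lists (S \<times> UNIV)"
    using u(1) by (induction u) auto
  have "pres_class S R ?r \<otimes>\<^bsub>?G\<^esub> x = \<one>\<^bsub>?G\<^esub>"
    using u r by (simp add: mult_presented_group one_presented_group pres_class_eq pres_eq_inverse_word)
  then show "\<exists>y\<in>carrier ?G. y \<otimes>\<^bsub>?G\<^esub> x = \<one>\<^bsub>?G\<^esub>"
    using r by (auto simp: carrier_presented_group)
  fix y assume "y \<in> carrier ?G"
  then obtain v where v: "v \<in> lists (S \<times> UNIV)" "y = pres_class S R v"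
    by (auto simp: carrier_presented_group)
  have uv: "u @ v \<in> lists (S \<times> UNIV)"
    using u v by auto
  show "x \<otimes>\<^bsub>?G\<^esub> y \<in> carrier ?G"
    using u v uv by (simp add: mult_presented_group carrier_presented_group del: append_in_lists_conv)
  fix z assume "z \<in> carrier ?G"
  then obtain w where w: "w \<in> lists (S \<times> UNIV)" "z = pres_class S R w"
    by (auto simp: carrier_presented_group)
  show "x \<otimes>\<^bsub>?G\<^esub> y \<otimes>\<^bsub>?G\<^esub> z = x \<otimes>\<^bsub>?G\<^esub> (y \<otimes>\<^bsub>?G\<^esub> z)"
    using u v w by (simp add: mult_presented_group)
qed


section \<open>Braid groups\<close>

definition braid_relations :: "nat \<Rightarrow> (nat word \<times> nat word) set" where
  "braid_relations n =
    {([(i, True), (j, True)], [(j, True), (i, True)]) | i j.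
       i \<in> {1..<n} \<and> j \<in> {1..<n} \<and> i + 2 \<le> j} \<union>
    {([(i, True), (i + 1, True), (i, True)], [(i + 1, True), (i, True), (i + 1, True)]) | i.
       i \<in> {1..<n} \<and> i + 1 \<in> {1..<n}}"

definition braid_group :: "nat \<Rightarrow> nat word set monoid" where
  "braid_group n = presented_group {1..<n} (braid_relations n)"

definition braid_class :: "nat \<Rightarrow> nat word \<Rightarrow> nat word set" where
  "braid_class n = pres_class {1..<n} (braid_relations n)"

definition artin_generator :: "nat \<Rightarrow> nat \<Rightarrow> nat word set" where
  "artin_generator n i = braid_class n [(i, True)]"

lemma group_braid_group: "group (braid_group n)"
  by (simp add: braid_group_def group_presented_group)

lemma carrier_braid_group:
  "carrier (braid_group n) = braid_class n ` lists ({1..<n} \<times> UNIV)"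
  by (simp add: braid_group_def braid_class_def carrier_presented_group)

lemma artin_generator_closed:
  "i \<in> {1..<n} \<Longrightarrow> artin_generator n i \<in> carrier (braid_group n)"
  by (auto simp: artin_generator_def carrier_braid_group)

text \<open>
  The map \<open>R\<^sub>*\<close> acts on words by replacing every letter \<open>\<sigma>\<^sub>3\<close> by \<open>\<sigma>\<^sub>1\<close>; all the words in a
  class \<open>X\<close> of \<open>B\<^sub>4\<close> contribute the same class of \<open>B\<^sub>3\<close> to the union below.
\<close>

definition R_letter :: "nat \<Rightarrow> nat" where
  "R_letter i = (if i = 3 then 1 else i)"

definition R_star :: "nat word set \<Rightarrow> nat word set" where
  "R_star X = (\<Union>w\<in>X. braid_class 3 (map (apfst R_letter) w))"

lemma R_letter_lists:
  "w \<in> lists ({1..<4} \<times> UNIV) \<Longrightarrow> map (apfst R_letter) w \<in> lists ({1..<3} \<times> UNIV)"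
  by (induction w) (auto simp: R_letter_def)

lemma R_letter_pres_eq:
  assumes "pres_eq {1..<4} (braid_relations 4) v w"
  shows "pres_eq {1..<3} (braid_relations 3) (map (apfst R_letter) v) (map (apfst R_letter) w)"
  using assms
proof (induction rule: pres_eq.induct)
  case (refl w)
  then show ?case by (intro pres_eq.refl R_letter_lists)
next
  case (sym v w)
  from sym.IH show ?case by (rule pres_eq.sym)
next
  case (trans u v w)
  from trans.IH show ?case by (rule pres_eq.trans)
next
  case (append u u' v v')
  from pres_eq.append[OF append.IH] show ?case by simp
next
  case (cancel s b)
  then have "R_letter s \<in> {1..<3}" by (auto simp: R_letter_def)
  then show ?case using pres_eq.cancel[of "R_letter s"] by simp
next
  case (rel u v)
  from rel(1) consider
      i j where "u = [(i, True), (j, True)]" "v = [(j, True), (i, True)]"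
        "i \<ge> 1" "j < 4" "i + 2 \<le> j"
    | i where "u = [(i, True), (i + 1, True), (i, True)]"
        "v = [(i + 1, True), (i, True), (i + 1, True)]" "i \<ge> 1" "i + 1 < 4"
    unfolding braid_relations_def by auto
  then show ?case
  proof cases
    case 1
    then have "i = 1" "j = 3" by auto
    with 1 show ?thesis by (auto simp: R_letter_def intro!: pres_eq.refl)
  next
    case 2
    then have i: "i = 1 \<or> i = 2" by auto
    have *: "pres_eq {1..<3} (braid_relations 3)
        [(1, True), (2, True), (1, True)] [(2, True), (1, True), (2, True)]"
      by (rule pres_eq.rel) (auto simp: braid_relations_def)
    from i show ?thesis
    proof
      assume "i = 1"
      with 2 * show ?thesis by (simp add: R_letter_def numeral_2_eq_2)
    next
      assume "i = 2"
      with 2 pres_eq.sym[OF *] show ?thesis by (simp add: R_letter_def)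
    qed
  qed
qed

lemma R_star_class:
  assumes "w \<in> lists ({1..<4} \<times> UNIV)"
  shows "R_star (braid_class 4 w) = braid_class 3 (map (apfst R_letter) w)"
proof -
  have "braid_class 3 (map (apfst R_letter) v) = braid_class 3 (map (apfst R_letter) w)"
    if "v \<in> braid_class 4 w" for v
    using that R_letter_pres_eq[of w v]
    unfolding braid_class_def pres_class_def[of _ _ w]
    by (metis mem_Collect_eq pres_class_eq)
  moreover have "w \<in> braid_class 4 w"
    using assms by (auto simp: braid_class_def pres_class_def intro: pres_eq.refl)
  ultimately show ?thesis
    unfolding R_star_def by blast
qed

lemma R_star_artin_generator:
  "R_star (artin_generator 4 1) = artin_generator 3 1"
  "R_star (artin_generator 4 2) = artin_generator 3 2"
  "R_star (artin_generator 4 3) = artin_generator 3 1"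
  by (simp_all add: artin_generator_def R_star_class R_letter_def)

lemma R_star_epi: "R_star \<in> epi (braid_group 4) (braid_group 3)"
proof -
  have "R_star \<in> hom (braid_group 4) (braid_group 3)"
  proof (rule homI)
    fix x y assume "x \<in> carrier (braid_group 4)" "y \<in> carrier (braid_group 4)"
    then obtain u v where u: "u \<in> lists ({1..<4} \<times> UNIV)" "x = braid_class 4 u"
      and v: "v \<in> lists ({1..<4} \<times> UNIV)" "y = braid_class 4 v"
      unfolding carrier_braid_group by blast
    note lu = R_letter_lists[OF u(1)] and lv = R_letter_lists[OF v(1)]
    show "R_star x \<in> carrier (braid_group 3)"
      unfolding u(2) R_star_class[OF u(1)] carrier_braid_group using lu by (rule imageI)
    have uv: "u @ v \<in> lists ({1..<4} \<times> UNIV)" using u v by auto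
    have "x \<otimes>\<^bsub>braid_group 4\<^esub> y = braid_class 4 (u @ v)"
      unfolding u(2) v(2) braid_group_def braid_class_def
      by (rule mult_presented_group[OF u(1) v(1)])
    moreover have "R_star x \<otimes>\<^bsub>braid_group 3\<^esub> R_star y =
        braid_class 3 (map (apfst R_letter) u @ map (apfst R_letter) v)"
      unfolding u(2) v(2) R_star_class[OF u(1)] R_star_class[OF v(1)]
      unfolding braid_group_def braid_class_def
      by (rule mult_presented_group[OF lu lv])
    ultimately show "R_star (x \<otimes>\<^bsub>braid_group 4\<^esub> y) = R_star x \<otimes>\<^bsub>braid_group 3\<^esub> R_star y"
      using R_star_class[OF uv] by simp
  qed
  moreover have "x \<in> R_star ` carrier (braid_group 4)" if "x \<in> carrier (braid_group 3)" for x
  proof -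
    from that obtain u where u: "u \<in> lists ({1..<3} \<times> UNIV)" "x = braid_class 3 u"
      unfolding carrier_braid_group by blast
    have u4: "u \<in> lists ({1..<4} \<times> UNIV)" using u(1) by fastforce
    have "map (apfst R_letter) u = u"
      using u(1) by (induction u) (auto simp: R_letter_def)
    then have "x = R_star (braid_class 4 u)" using R_star_class[OF u4] u(2) by simp
    then show ?thesis using u4 by (auto simp: carrier_braid_group)
  qed
  ultimately show ?thesis
    by (auto simp: epi_def hom_def)
qed


section \<open>The modular group\<close>

definition SL2Z :: "(int^2^2) monoid" where
  "SL2Z = \<lparr>carrier = {A. det A = 1}, monoid.mult = (**), one = mat 1\<rparr>"

definition PSL2Z :: "(int^2^2) set monoid" where
  "PSL2Z = SL2Z Mod {mat 1, - mat 1}"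

lemma group_SL2Z: "group SL2Z"
proof (rule groupI)
  fix A assume "A \<in> carrier SL2Z"
  then have A: "A$1$1 * A$2$2 - A$1$2 * A$2$1 = 1"
    by (simp add: SL2Z_def det_2)
  define B :: "int^2^2" where "B = vector [vector [A$2$2, - A$1$2], vector [- A$2$1, A$1$1]]"
  have "det B = 1" using A by (simp add: B_def det_2 mult.commute)
  moreover have "B ** A = mat 1"
    using A by (simp add: B_def matrix_matrix_mult_def mat_def vec_eq_iff forall_2 sum_2 algebra_simps)
  ultimately show "\<exists>B\<in>carrier SL2Z. B \<otimes>\<^bsub>SL2Z\<^esub> A = \<one>\<^bsub>SL2Z\<^esub>"
    by (auto simp: SL2Z_def)
qed (auto simp: SL2Z_def det_mul matrix_mul_assoc)

lemma normal_pm_one_SL2Z: "{mat 1, - mat 1} \<lhd> SL2Z"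
proof -
  interpret group SL2Z by (rule group_SL2Z)
  have neg: "(- mat 1) ** A = - A" "A ** (- mat 1) = - A" for A :: "int^2^2"
    by (simp_all add: matrix_matrix_mult_def mat_def vec_eq_iff forall_2 sum_2)
  have d: "det (- mat 1 :: int^2^2) = 1" by (simp add: det_2 mat_def)
  have inv_neg: "inv\<^bsub>SL2Z\<^esub> (- mat 1) = - mat 1"
    by (rule inv_equality) (auto simp: SL2Z_def d neg)
  have "subgroup {mat 1, - mat 1} SL2Z"
  proof (rule subgroupI)
    fix a assume "a \<in> {mat 1, - mat 1 :: int^2^2}"
    then show "inv\<^bsub>SL2Z\<^esub> a \<in> {mat 1, - mat 1}"
      using inv_neg inv_one by (auto simp: SL2Z_def)
  qed (auto simp: SL2Z_def d neg)
  moreover have "x \<otimes>\<^bsub>SL2Z\<^esub> h \<otimes>\<^bsub>SL2Z\<^esub> inv\<^bsub>SL2Z\<^esub> x \<in> {mat 1, - mat 1}"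
    if x: "x \<in> carrier SL2Z" and h: "h \<in> {mat 1, - mat 1}" for x h
  proof -
    have c: "- mat 1 \<in> carrier SL2Z" by (simp add: SL2Z_def d)
    have "x \<otimes>\<^bsub>SL2Z\<^esub> h = h \<otimes>\<^bsub>SL2Z\<^esub> x" "h \<in> carrier SL2Z"
      using h c by (auto simp: SL2Z_def neg)
    then have "x \<otimes>\<^bsub>SL2Z\<^esub> h \<otimes>\<^bsub>SL2Z\<^esub> inv\<^bsub>SL2Z\<^esub> x = h"
      using x by (simp add: m_assoc)
    with h show ?thesis by simp
  qed
  ultimately show ?thesis by (auto simp: normal_inv_iff)
qed

lemma group_PSL2Z: "group PSL2Z"
  unfolding PSL2Z_def by (rule normal.factorgroup_is_group[OF normal_pm_one_SL2Z])


section \<open>Cyclic homomorphisms and the center\<close>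

definition cyclic_hom :: "('a, 'm) monoid_scheme \<Rightarrow> ('b, 'n) monoid_scheme \<Rightarrow> ('a \<Rightarrow> 'b) \<Rightarrow> bool" where
  "cyclic_hom G H f \<longleftrightarrow> f \<in> hom G H \<and> cyclic_group (H\<lparr>carrier := f ` carrier G\<rparr>)"

definition group_center :: "('a, 'm) monoid_scheme \<Rightarrow> 'a set" where
  "group_center G = {z \<in> carrier G. \<forall>x\<in>carrier G. z \<otimes>\<^bsub>G\<^esub> x = x \<otimes>\<^bsub>G\<^esub> z}"

lemma (in group) normal_group_center: "group_center G \<lhd> G"
proof -
  have "subgroup (group_center G) G"
  proof (rule subgroupI)
    fix a assume a: "a \<in> group_center G"
    have "inv a \<otimes> x = x \<otimes> inv a" if x: "x \<in> carrier G" for x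
    proof -
      have "a \<otimes> x = x \<otimes> a" "a \<in> carrier G" using a x by (auto simp: group_center_def)
      then have "x = inv a \<otimes> (x \<otimes> a)" using x by (metis inv_solve_left m_closed)
      then have "x \<otimes> inv a = inv a \<otimes> x \<otimes> a \<otimes> inv a"
        using x \<open>a \<in> carrier G\<close> by (simp add: m_assoc)
      then show ?thesis using x \<open>a \<in> carrier G\<close> by (simp add: m_assoc)
    qed
    then show "inv a \<in> group_center G" using a by (auto simp: group_center_def)
    fix b assume b: "b \<in> group_center G"
    have "a \<otimes> b \<otimes> x = x \<otimes> (a \<otimes> b)" if x: "x \<in> carrier G" for x
    proof -
      have "a \<in> carrier G" "b \<in> carrier G" "a \<otimes> x = x \<otimes> a" "b \<otimes> x = x \<otimes> b"
        using a b x by (auto simp: group_center_def)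
      with x show ?thesis by (metis m_assoc)
    qed
    moreover have "a \<otimes> b \<in> carrier G"
      using a b by (intro m_closed) (auto simp only: group_center_def mem_Collect_eq)
    ultimately show "a \<otimes> b \<in> group_center G" unfolding group_center_def by blast
  next
    show "group_center G \<subseteq> carrier G" by (auto simp only: group_center_def)
    have "\<one> \<in> group_center G" by (simp add: group_center_def)
    then show "group_center G \<noteq> {}" by blast
  qed
  moreover have "x \<otimes> h \<otimes> inv x \<in> group_center G"
    if x: "x \<in> carrier G" and h: "h \<in> group_center G" for x h
  proof -
    have "h \<otimes> x = x \<otimes> h" "h \<in> carrier G" using x h by (auto simp: group_center_def)
    then have "x \<otimes> h \<otimes> inv x = h \<otimes> x \<otimes> inv x" by simp
    also have "\<dots> = h" using x \<open>h \<in> carrier G\<close> by (simp add: m_assoc)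
    finally show ?thesis using h by metis
  qed
  ultimately show ?thesis by (auto simp: normal_inv_iff)
qed

end

theory Submission
  imports Defs
begin

text \<open>
  Elements of \<open>PSL\<^sub>2\<int>\<close> satisfying the braid relation lift, after a choice of signs, to matrices \<open>A\<close>, \<open>B\<close>
  in \<open>SL\<^sub>2\<int>\<close> with \<open>A B A = B A B\<close>; they are then conjugate, and Cayley--Hamilton turns the relation
  into \<open>(tr (A B) - 1) (A - B) = 0\<close>. Elements commuting in \<open>PSL\<^sub>2\<int>\<close> have commuting lifts, since
  anticommutation would give a copy of the quaternion group in \<open>SL\<^sub>2\<real>\<close>. If \<open>\<sigma>\<^sub>1, \<sigma>\<^sub>2, \<sigma>\<^sub>3\<close> map to the
  classes of \<open>A\<close>, \<open>B\<close>, \<open>C\<close>, then \<open>A\<close> and \<open>C\<close> commute and have the same trace and the same pairing with \<open>B\<close>,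
  which forces \<open>A = C\<close>; this is the case \<open>n = 4\<close>. For \<open>n \<ge> 5\<close> the images of \<open>\<sigma>\<^sub>2\<close> and \<open>\<sigma>\<^sub>4\<close> also agree,
  so those of \<open>\<sigma>\<^sub>1\<close> and \<open>\<sigma>\<^sub>2\<close> commute, hence coincide. For \<open>n = 3\<close> a central element maps to an element
  commuting with two noncommuting elements of \<open>PSL\<^sub>2\<int>\<close>, which must be trivial.
\<close>

section \<open>Homomorphisms out of a presented group\<close>

lemma pres_class_closed:
  "w \<in> lists (S \<times> UNIV) \<Longrightarrow> pres_class S R w \<in> carrier (presented_group S R)"
  by (simp add: carrier_presented_group)

text \<open>Acts on raw words rather than classes, so that invariance under \<open>pres_eq\<close>
  becomes a separate statement.\<close>

definition word_value :: "('b, 'm) monoid_scheme \<Rightarrow> ('a \<Rightarrow> 'b) \<Rightarrow> 'a word \<Rightarrow> 'b" where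
  "word_value H f w =
    foldr (\<lambda>(s, b) x. (if b then f s else inv\<^bsub>H\<^esub> f s) \<otimes>\<^bsub>H\<^esub> x) w \<one>\<^bsub>H\<^esub>"

lemma word_value_Nil [simp]: "word_value H f [] = \<one>\<^bsub>H\<^esub>"
  by (simp add: word_value_def)

lemma word_value_Cons [simp]:
  "word_value H f ((s, b) # w) = (if b then f s else inv\<^bsub>H\<^esub> f s) \<otimes>\<^bsub>H\<^esub> word_value H f w"
  by (simp add: word_value_def)

context group
begin

lemma word_value_closed:
  assumes "f \<in> S \<rightarrow> carrier G" "w \<in> lists (S \<times> UNIV)"
  shows "word_value G f w \<in> carrier G"
  using assms(2)
proof (induction w rule: list.induct)
  case (Cons l w)
  then show ?case using assms(1) by (cases l) (auto simp: Pi_iff)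
qed simp

lemma word_value_append:
  assumes "f \<in> S \<rightarrow> carrier G" "u \<in> lists (S \<times> UNIV)" "v \<in> lists (S \<times> UNIV)"
  shows "word_value G f (u @ v) = word_value G f u \<otimes> word_value G f v"
  using assms(2)
proof (induction u rule: list.induct)
  case Nil
  then show ?case using word_value_closed[OF assms(1,3)] by simp
next
  case (Cons l u)
  obtain s b where l: "l = (s, b)" by fastforce
  have "f s \<in> carrier G" "u \<in> lists (S \<times> UNIV)"
    using Cons.prems assms(1) l by (auto simp: Pi_iff)
  then show ?case
    using Cons.IH l word_value_closed[OF assms(1)] assms(3) by (simp add: m_assoc)
qed

text \<open>Induction on the derivation: every closure rule of \<open>pres_eq\<close> is a group
  law, and only the rule \<open>rel\<close> calls on the hypothesis about \<open>R\<close>.\<close>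

lemma word_value_pres_eq:
  assumes f: "f \<in> S \<rightarrow> carrier G"
    and R: "\<And>u v. (u, v) \<in> R \<Longrightarrow> word_value G f u = word_value G f v"
    and "pres_eq S R v w"
  shows "word_value G f v = word_value G f w"
  using assms(3)
proof (induction rule: pres_eq.induct)
  case (append u u' v v')
  then show ?case
    using pres_eq_lists[OF append.hyps(1)] pres_eq_lists[OF append.hyps(2)]
    by (simp add: word_value_append[OF f])
next
  case (cancel s b)
  then have "f s \<in> carrier G" using f by auto
  then show ?case by simp
qed (simp_all add: R)

text \<open>Von Dyck's theorem; it produces the factor map out of \<open>braid_group 3\<close> in
  the case of four strands.\<close>

theorem presented_group_universal:
  assumes f: "f \<in> S \<rightarrow> carrier G"
    and R: "\<And>u v. (u, v) \<in> R \<Longrightarrow> word_value G f u = word_value G f v"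
  obtains \<psi> where "\<psi> \<in> hom (presented_group S R) G"
    and "\<And>s. s \<in> S \<Longrightarrow> \<psi> (pres_class S R [(s, True)]) = f s"
proof -
  \<comment> \<open>The arbitrary representative is harmless, since equivalent words have the same
    value.\<close>
  define \<psi> where "\<psi> X = word_value G f (SOME w. w \<in> X)" for X
  have \<psi>: "\<psi> (pres_class S R w) = word_value G f w" if "w \<in> lists (S \<times> UNIV)" for w
  proof -
    have "w \<in> pres_class S R w"
      using that by (simp add: pres_class_def pres_eq.refl)
    then have "(SOME v. v \<in> pres_class S R w) \<in> pres_class S R w"
      by (rule someI)
    then show ?thesis
      unfolding \<psi>_def pres_class_def[of S R w] using word_value_pres_eq[OF f R, where v = w] by simp
  qed
  have "\<psi> \<in> hom (presented_group S R) G"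
  proof (rule homI)
    fix x y assume "x \<in> carrier (presented_group S R)" "y \<in> carrier (presented_group S R)"
    then obtain u v where u: "u \<in> lists (S \<times> UNIV)" "x = pres_class S R u"
      and v: "v \<in> lists (S \<times> UNIV)" "y = pres_class S R v"
      unfolding carrier_presented_group by blast
    show "\<psi> x \<in> carrier G"
      using u by (simp add: \<psi> word_value_closed[OF f])
    have "u @ v \<in> lists (S \<times> UNIV)" using u v by simp
    then show "\<psi> (x \<otimes>\<^bsub>presented_group S R\<^esub> y) = \<psi> x \<otimes> \<psi> y"
      unfolding u(2) v(2) using u(1) v(1)
      by (simp only: \<psi> mult_presented_group word_value_append[OF f])
  qed
  moreover have "\<psi> (pres_class S R [(s, True)]) = f s" if "s \<in> S" for s
  proof -
    have "f s \<in> carrier G" using that f by auto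
    then show ?thesis using that by (simp add: \<psi>)
  qed
  ultimately show thesis by (rule that)
qed

lemma hom_pres_class:
  assumes "\<psi> \<in> hom (presented_group S R) G" "w \<in> lists (S \<times> UNIV)"
  shows "\<psi> (pres_class S R w) = word_value G (\<lambda>s. \<psi> (pres_class S R [(s, True)])) w"
proof -
  interpret \<psi>: group_hom "presented_group S R" G \<psi>
    using assms(1) group_presented_group[of S R] is_group
    by (simp add: group_hom_def group_hom_axioms_def)
  show ?thesis
    using assms(2)
  proof (induction w rule: list.induct)
    case Nil
    then show ?case using \<psi>.hom_one by (simp add: one_presented_group)
  next
    case (Cons l w)
    obtain s b where l: "l = (s, b)" by fastforce
    have s: "s \<in> S" and w: "w \<in> lists (S \<times> UNIV)" using Cons.prems l by auto
    have letter: "[(s, b')] \<in> lists (S \<times> UNIV)" for b' using s by simp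
    \<comment> \<open>The cancellation rule makes the class of a formal inverse letter an actual
      inverse, which any homomorphism preserves.\<close>
    have "pres_class S R [(s, False)] \<otimes>\<^bsub>presented_group S R\<^esub> pres_class S R [(s, True)] =
        \<one>\<^bsub>presented_group S R\<^esub>"
      using s pres_eq.cancel[OF s, of R False]
      by (simp add: mult_presented_group one_presented_group pres_class_eq)
    then have "pres_class S R [(s, False)] = inv\<^bsub>presented_group S R\<^esub> pres_class S R [(s, True)]"
      using \<psi>.G.inv_equality pres_class_closed[OF letter] by metis
    then have "\<psi> (pres_class S R [(s, b)]) =
        (if b then \<psi> (pres_class S R [(s, True)]) else inv \<psi> (pres_class S R [(s, True)]))"
      using pres_class_closed[OF letter] by simp
    moreover have "\<psi> (pres_class S R (l # w)) =
        \<psi> (pres_class S R [(s, b)]) \<otimes> \<psi> (pres_class S R w)"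
      using mult_presented_group[OF letter[of b] w, where R = R] pres_class_closed[OF letter] pres_class_closed[OF w]
        \<psi>.hom_mult l by (metis append_Cons append_Nil)
    ultimately show ?case using Cons.IH[OF w] l by simp
  qed
qed

lemma hom_presented_group_eqI:
  assumes "\<psi> \<in> hom (presented_group S R) G" "\<psi>' \<in> hom (presented_group S R) G"
    and "\<And>s. s \<in> S \<Longrightarrow> \<psi> (pres_class S R [(s, True)]) = \<psi>' (pres_class S R [(s, True)])"
    and "x \<in> carrier (presented_group S R)"
  shows "\<psi> x = \<psi>' x"
proof -
  obtain w where w: "w \<in> lists (S \<times> UNIV)" "x = pres_class S R w"
    using assms(4) by (auto simp: carrier_presented_group)
  have "word_value G (\<lambda>s. \<psi> (pres_class S R [(s, True)])) w =
      word_value G (\<lambda>s. \<psi>' (pres_class S R [(s, True)])) w"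
    using w(1)
  proof (induction w rule: list.induct)
    case (Cons l w)
    then show ?case using assms(3) by (cases l) auto
  qed simp
  then show ?thesis
    using w hom_pres_class[OF assms(1)] hom_pres_class[OF assms(2)] by simp
qed

lemma word_value_in_generate:
  assumes "\<And>s. s \<in> S \<Longrightarrow> f s \<in> K" "w \<in> lists (S \<times> UNIV)"
  shows "word_value G f w \<in> generate G K"
  using assms(2)
proof (induction w rule: list.induct)
  case Nil
  then show ?case by (simp add: generate.one)
next
  case (Cons l w)
  then show ?case using assms(1)
    by (cases l) (auto intro!: generate.eng intro: generate.incl generate.inv)
qed

text \<open>Lets cyclicity be read off from the images of the generators.\<close>

lemma hom_presented_group_image:
  assumes "\<psi> \<in> hom (presented_group S R) G"
  shows "\<psi> ` carrier (presented_group S R) =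
    generate G ((\<lambda>s. \<psi> (pres_class S R [(s, True)])) ` S)" (is "?I = generate G ?K")
proof
  interpret \<psi>: group_hom "presented_group S R" G \<psi>
    using assms group_presented_group[of S R] is_group
    by (simp add: group_hom_def group_hom_axioms_def)
  have "?K \<subseteq> ?I"
    by (auto intro!: imageI pres_class_closed)
  then show "generate G ?K \<subseteq> ?I"
    by (rule generate_subgroup_incl[OF _ \<psi>.img_is_subgroup])
  show "?I \<subseteq> generate G ?K"
  proof
    fix y assume "y \<in> ?I"
    then obtain w where w: "w \<in> lists (S \<times> UNIV)" "y = \<psi> (pres_class S R w)"
      by (auto simp: carrier_presented_group)
    show "y \<in> generate G ?K"
      unfolding w(2) hom_pres_class[OF assms w(1)] using w(1) by (intro word_value_in_generate) auto
  qed
qed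

end


section \<open>Braid relations and homomorphisms out of braid groups\<close>

lemma artin_generators_commute:
  assumes "1 \<le> i" "i + 2 \<le> j" "j < n"
  shows "artin_generator n i \<otimes>\<^bsub>braid_group n\<^esub> artin_generator n j =
    artin_generator n j \<otimes>\<^bsub>braid_group n\<^esub> artin_generator n i"
proof -
  have "pres_eq {1..<n} (braid_relations n) [(i, True), (j, True)] [(j, True), (i, True)]"
    using assms by (intro pres_eq.rel) (auto simp: braid_relations_def)
  then show ?thesis
    using assms
    by (simp add: artin_generator_def braid_class_def braid_group_def mult_presented_group pres_class_eq)
qed

lemma artin_generators_braid:
  assumes "1 \<le> i" "i + 1 < n"
  shows "artin_generator n i \<otimes>\<^bsub>braid_group n\<^esub> artin_generator n (i + 1)
      \<otimes>\<^bsub>braid_group n\<^esub> artin_generator n i =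
    artin_generator n (i + 1) \<otimes>\<^bsub>braid_group n\<^esub> artin_generator n i
      \<otimes>\<^bsub>braid_group n\<^esub> artin_generator n (i + 1)"
proof -
  have "pres_eq {1..<n} (braid_relations n)
      [(i, True), (i + 1, True), (i, True)] [(i + 1, True), (i, True), (i + 1, True)]"
    using assms by (intro pres_eq.rel) (auto simp: braid_relations_def)
  then show ?thesis
    using assms
    by (simp add: artin_generator_def braid_class_def braid_group_def mult_presented_group pres_class_eq)
qed

lemma hom_artin_generators_commute:
  assumes "\<phi> \<in> hom (braid_group n) H" "1 \<le> i" "i + 2 \<le> j" "j < n"
  shows "\<phi> (artin_generator n i) \<otimes>\<^bsub>H\<^esub> \<phi> (artin_generator n j) =
    \<phi> (artin_generator n j) \<otimes>\<^bsub>H\<^esub> \<phi> (artin_generator n i)"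
proof -
  have "artin_generator n i \<in> carrier (braid_group n)" "artin_generator n j \<in> carrier (braid_group n)"
    using assms by (auto intro: artin_generator_closed)
  then show ?thesis
    using artin_generators_commute[OF assms(2-4)] hom_mult[OF assms(1)] by metis
qed

lemma hom_artin_generators_braid:
  assumes "\<phi> \<in> hom (braid_group n) H" "1 \<le> i" "i + 1 < n"
  shows "\<phi> (artin_generator n i) \<otimes>\<^bsub>H\<^esub> \<phi> (artin_generator n (i + 1)) \<otimes>\<^bsub>H\<^esub> \<phi> (artin_generator n i) =
    \<phi> (artin_generator n (i + 1)) \<otimes>\<^bsub>H\<^esub> \<phi> (artin_generator n i) \<otimes>\<^bsub>H\<^esub> \<phi> (artin_generator n (i + 1))"
proof -
  interpret group "braid_group n" by (rule group_braid_group)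
  have *: "artin_generator n i \<in> carrier (braid_group n)"
    "artin_generator n (i + 1) \<in> carrier (braid_group n)"
    using assms by (auto intro: artin_generator_closed)
  have "\<phi> (x \<otimes>\<^bsub>braid_group n\<^esub> y \<otimes>\<^bsub>braid_group n\<^esub> x) = \<phi> x \<otimes>\<^bsub>H\<^esub> \<phi> y \<otimes>\<^bsub>H\<^esub> \<phi> x"
    if "x \<in> carrier (braid_group n)" "y \<in> carrier (braid_group n)" for x y
    using that hom_mult[OF assms(1)] by simp
  from this[OF *] this[OF *(2,1)] show ?thesis
    using artin_generators_braid[OF assms(2,3)] by simp
qed

lemma cyclic_hom_braid_groupI:
  assumes "group H" "\<phi> \<in> hom (braid_group n) H" "1 < n"
    and "\<And>i. i \<in> {1..<n} \<Longrightarrow> \<phi> (artin_generator n i) = g"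
  shows "cyclic_hom (braid_group n) H \<phi>"
proof -
  interpret group H by (rule assms(1))
  \<comment> \<open>By \<open>1 < n\<close> there is at least one generator, so \<open>g\<close> is
    attained and the set of images is exactly \<open>{g}\<close>.\<close>
  have "g = \<phi> (artin_generator n 1)" "artin_generator n 1 \<in> carrier (braid_group n)"
    using assms(3,4) by (auto intro: artin_generator_closed)
  then have g: "g \<in> carrier H" using assms(2) by (simp add: hom_in_carrier)
  have "\<phi> ` carrier (braid_group n) = generate H ((\<lambda>i. \<phi> (artin_generator n i)) ` {1..<n})"
    using hom_presented_group_image assms(2)
    unfolding braid_group_def artin_generator_def braid_class_def by metis
  also have "(\<lambda>i. \<phi> (artin_generator n i)) ` {1..<n} = {g}"
  proof -
    have "1 \<in> {1..<n}" using assms(3) by simp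
    then show ?thesis using assms(4) by (auto simp: image_iff)
  qed
  finally have "H\<lparr>carrier := \<phi> ` carrier (braid_group n)\<rparr> = subgroup_generated H {g}"
    using g by (simp add: subgroup_generated_def)
  then show ?thesis
    using assms(2) cyclic_group_generated by (simp add: cyclic_hom_def)
qed

text \<open>Commutativity turns \<open>b a b\<close> into \<open>a b b\<close>; cancelling
  \<open>a b\<close> on the left finishes.\<close>

lemma (in group) braid_commute_imp_eq:
  assumes "a \<in> carrier G" "b \<in> carrier G" "a \<otimes> b \<otimes> a = b \<otimes> a \<otimes> b" "a \<otimes> b = b \<otimes> a"
  shows "a = b"
proof -
  have "a \<otimes> b \<otimes> a = a \<otimes> b \<otimes> b" using assms(3,4) by simp
  then show ?thesis using assms(1,2) by simp
qed


section \<open>Two-by-two integer matrices\<close>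

lemma det_uminus_2: "det (- A) = det A" for A :: "int^2^2"
  by (simp add: det_2)

lemma trace_2: "trace A = A$1$1 + A$2$2" for A :: "int^2^2"
  by (simp add: trace_def sum_2)

lemma matrix_mult_2: "(A ** B)$i$j = A$i$1 * B$1$j + A$i$2 * B$2$j" for A B :: "int^2^2"
  by (simp add: matrix_matrix_mult_def sum_2)

lemma uminus_matrix_mult_2: "(- A) ** B = - (A ** B)" "A ** (- B) = - (A ** B)" for A B :: "int^2^2"
  by (simp_all add: vec_eq_iff matrix_mult_2)

lemma matrix_eq_2: "A = B \<longleftrightarrow> A$1$1 = B$1$1 \<and> A$1$2 = B$1$2 \<and> A$2$1 = B$2$1 \<and> A$2$2 = B$2$2"
  for A B :: "int^2^2"
  by (auto simp: vec_eq_iff forall_2)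

lemma SL2_not_anticommute:
  fixes A C :: "int^2^2"
  assumes "det A = 1" "det C = 1"
  shows "A ** C \<noteq> - (C ** A)"
proof
  assume anti: "A ** C = - (C ** A)"
  define a b c d where abcd: "a = A$1$1" "b = A$1$2" "c = A$2$1" "d = A$2$2"
  define p q r s where pqrs: "p = C$1$1" "q = C$1$2" "r = C$2$1" "s = C$2$2"
  have dA: "a * d - b * c = 1" and dC: "p * s - q * r = 1"
    using assms by (simp_all add: det_2 abcd pqrs)
  have e: "2 * (a * p) + b * r + q * c = 0" "q * (a + d) + b * (p + s) = 0"
    "r * (a + d) + c * (p + s) = 0" "2 * (d * s) + b * r + q * c = 0"
    using anti by (simp_all add: matrix_eq_2 matrix_mult_2 abcd pqrs algebra_simps)
  \<comment> \<open>Conjugating \<open>C\<close> by \<open>A\<close> negates it, so its trace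
    vanishes; the same holds with the roles exchanged.\<close>
  have "p + s = 0"
    using dA dC e by algebra
  moreover have "a + d = 0"
    using dA dC e by algebra
  ultimately have "s = - p" "d = - a" by simp_all
  then have "b * c = - 1 - a * a" "q * r = - 1 - p * p" "b * r + q * c = - 2 * (a * p)"
    using dA dC e by (simp_all add: algebra_simps)
  \<comment> \<open>Uses (x - y)^2 = (x + y)^2 - 4 x y with x = b r and y = q c, where x y = (b c)(q
    r). The result is negative, which is impossible for a square.\<close>
  then have "(b * r - q * c)\<^sup>2 = - 4 * (1 + a\<^sup>2 + p\<^sup>2)"
    by algebra
  moreover have "- 4 * (1 + a\<^sup>2 + p\<^sup>2) < 0"
    by (intro mult_neg_pos add_pos_nonneg) simp_all
  ultimately have "(b * r - q * c)\<^sup>2 < 0" by (simp only:)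
  then show False by simp
qed

text \<open>Conjugacy is written without an inverse, so that the claim is polynomial in the integer
  entries.\<close>

lemma conjugate_trace_eq:
  fixes A B M :: "int^2^2"
  assumes "det M = 1" "M ** A = B ** M"
  shows "trace A = trace B"
proof -
  have "M$1$1 * M$2$2 - M$1$2 * M$2$1 = 1" using assms(1) by (simp add: det_2)
  moreover have "M$1$1 * A$1$1 + M$1$2 * A$2$1 = B$1$1 * M$1$1 + B$1$2 * M$2$1"
    "M$1$1 * A$1$2 + M$1$2 * A$2$2 = B$1$1 * M$1$2 + B$1$2 * M$2$2"
    "M$2$1 * A$1$1 + M$2$2 * A$2$1 = B$2$1 * M$1$1 + B$2$2 * M$2$1"
    "M$2$1 * A$1$2 + M$2$2 * A$2$2 = B$2$1 * M$1$2 + B$2$2 * M$2$2"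
    using assms(2) by (simp_all add: matrix_eq_2 matrix_mult_2)
  ultimately have "A$1$1 + A$2$2 = B$1$1 + B$2$2" by algebra
  then show ?thesis by (simp add: trace_2)
qed

text \<open>By Cayley--Hamilton, \<open>A B A = tr (A B) A - det A adj B\<close>.\<close>

lemma matrix_mult_ABA_entries:
  fixes A B :: "int^2^2"
  shows "(A ** B ** A)$1$1 = trace (A ** B) * A$1$1 - det A * B$2$2"
    "(A ** B ** A)$1$2 = trace (A ** B) * A$1$2 + det A * B$1$2"
    "(A ** B ** A)$2$1 = trace (A ** B) * A$2$1 + det A * B$2$1"
    "(A ** B ** A)$2$2 = trace (A ** B) * A$2$2 - det A * B$1$1"
  by (simp_all add: matrix_mult_2 trace_2 det_2 algebra_simps)

lemma SL2_braid_trace: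
  fixes A B :: "int^2^2"
  assumes "det A = 1" "det B = 1" "A ** B ** A = B ** A ** B"
  shows "trace A = trace B" and "A \<noteq> B \<Longrightarrow> trace (A ** B) = 1"
proof -
  have "det (A ** B) = 1" using assms by (simp add: det_mul)
  \<comment> \<open>Regrouped, the braid relation says that \<open>A B\<close> conjugates
    \<open>A\<close> into \<open>B\<close>.\<close>
  moreover have "(A ** B) ** A = B ** (A ** B)"
    using assms(3) by (simp add: matrix_mul_assoc)
  ultimately show tr: "trace A = trace B" by (rule conjugate_trace_eq)
  define z where "z = trace (A ** B)"
  have zBA: "trace (B ** A) = z" by (simp add: z_def trace_2 matrix_mult_2 algebra_simps)
  \<comment> \<open>Entries of z A - adj B = z B - adj A. As adj X = tr X - X and the traces agree,
    this amounts to (z - 1)(A - B) = 0.\<close>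
  have "z * A$1$1 - B$2$2 = z * B$1$1 - A$2$2" "z * A$1$2 + B$1$2 = z * B$1$2 + A$1$2"
      "z * A$2$1 + B$2$1 = z * B$2$1 + A$2$1" "z * A$2$2 - B$1$1 = z * B$2$2 - A$1$1"
    using assms(3) unfolding matrix_eq_2 matrix_mult_ABA_entries zBA z_def[symmetric] assms(1,2)
    by simp_all
  moreover have "A$1$1 + A$2$2 = B$1$1 + B$2$2" using tr by (simp only: trace_2)
  ultimately have "(z - 1) * (A$1$1 - B$1$1) = 0" "(z - 1) * (A$1$2 - B$1$2) = 0"
      "(z - 1) * (A$2$1 - B$2$1) = 0" "(z - 1) * (A$2$2 - B$2$2) = 0"
    by algebra+
  then show "trace (A ** B) = 1" if "A \<noteq> B"
    using that unfolding z_def[symmetric] by (auto simp: matrix_eq_2)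
qed

text \<open>
  The trace-free part of a matrix is encoded by the triple of \<open>A$1$1 - A$2$2\<close>, \<open>A$1$2\<close>, \<open>A$2$1\<close>;
  two matrices commute exactly if these triples are proportional.
\<close>

lemma commute_iff_2:
  fixes A C :: "int^2^2"
  shows "A ** C = C ** A \<longleftrightarrow>
    A$1$2 * C$2$1 = C$1$2 * A$2$1 \<and>
    (A$1$1 - A$2$2) * C$1$2 = A$1$2 * (C$1$1 - C$2$2) \<and>
    (A$1$1 - A$2$2) * C$2$1 = A$2$1 * (C$1$1 - C$2$2)"
  by (auto simp: matrix_eq_2 matrix_mult_2 algebra_simps)

text \<open>
  Pairing the trace-free parts of \<open>A\<close> and \<open>C\<close> with \<open>B\<close> gives the same value \<open>1 - t\<^sup>2 / 2\<close>, \<open>t\<close> being the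
  common trace. It is nonzero because 2 is not a square, so the proportionality factor is 1.
\<close>

lemma commuting_eq_if_traces:
  fixes A B C :: "int^2^2"
  assumes "trace A = t" "trace B = t" "trace C = t" "trace (A ** B) = 1" "trace (C ** B) = 1"
    and "A ** C = C ** A"
  shows "A = C"
proof -
  define a b c d where abcd: "a = A$1$1" "b = A$1$2" "c = A$2$1" "d = A$2$2"
  define p q r s where pqrs: "p = C$1$1" "q = C$1$2" "r = C$2$1" "s = C$2$2"
  define e f g h where efgh: "e = B$1$1" "f = B$1$2" "g = B$2$1" "h = B$2$2"
  have t: "a + d = t" "e + h = t" "p + s = t" "a * e + b * g + c * f + d * h = 1"
      "p * e + q * g + r * f + s * h = 1"
    using assms(1-5) by (simp_all add: trace_2 matrix_mult_2 abcd pqrs efgh algebra_simps)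
  have k: "b * r = q * c" "(a - d) * q = b * (p - s)" "(a - d) * r = c * (p - s)"
    using assms(6) by (simp_all add: commute_iff_2 abcd pqrs)
  \<comment> \<open>Twice the trace pairing of the trace-free parts, i.e. 2 tr (A B) - tr A tr B,
    doubled to stay within the integers.\<close>
  have lA: "(a - d) * (e - h) + 2 * (b * g) + 2 * (c * f) = 2 - t\<^sup>2"
    and lC: "(p - s) * (e - h) + 2 * (q * g) + 2 * (r * f) = 2 - t\<^sup>2"
  proof -
    have "t\<^sup>2 = (a + d) * (e + h)" using t by (simp add: power2_eq_square)
    then show "(a - d) * (e - h) + 2 * (b * g) + 2 * (c * f) = 2 - t\<^sup>2"
      using t(4) by algebra
    have "t\<^sup>2 = (p + s) * (e + h)" using t by (simp add: power2_eq_square)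
    then show "(p - s) * (e - h) + 2 * (q * g) + 2 * (r * f) = 2 - t\<^sup>2"
      using t(5) by algebra
  qed
  \<comment> \<open>Multiply \<open>lC\<close> by \<open>a - d\<close>, \<open>b\<close> or
    \<open>c\<close>; the proportions \<open>k\<close> turn its left side into that of
    \<open>lA\<close> times \<open>p - s\<close>, \<open>q\<close> or \<open>r\<close>.\<close>
  have "(2 - t\<^sup>2) * ((a - d) - (p - s)) = 0" "(2 - t\<^sup>2) * (b - q) = 0" "(2 - t\<^sup>2) * (c - r) = 0"
    using k lA lC by algebra+
  moreover have "t\<^sup>2 \<noteq> 2"
  proof
    assume t2: "t\<^sup>2 = 2"
    then have "\<bar>t\<bar> < 2" by (intro power2_less_imp_less[of _ 2]) auto
    then have "t = -1 \<or> t = 0 \<or> t = 1" by arith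
    then show False using t2 by auto
  qed
  ultimately have "a - d = p - s" "b = q" "c = r" by auto
  then show ?thesis using t abcd pqrs by (simp add: matrix_eq_2)
qed

text \<open>If the trace-free part of \<open>Z\<close> is nonzero, those of \<open>A\<close> and
  \<open>B\<close> are rational multiples of it and so proportional to each other. If it vanishes,
  \<open>Z\<close> is scalar of determinant 1.\<close>

lemma commute_trans_or_scalar:
  fixes A B Z :: "int^2^2"
  assumes "det Z = 1" "A ** Z = Z ** A" "B ** Z = Z ** B"
  shows "A ** B = B ** A \<or> Z = mat 1 \<or> Z = - mat 1"
proof (cases "Z$1$2 = 0 \<and> Z$2$1 = 0 \<and> Z$1$1 = Z$2$2")
  case True
  then have "Z$1$1 * Z$1$1 = 1" using assms(1) by (simp add: det_2)
  then have "Z$1$1 = 1 \<or> Z$1$1 = -1" by (simp add: square_eq_1_iff)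
  then show ?thesis using True by (auto simp: matrix_eq_2 mat_def)
next
  case False
  define a b c where abc: "a = A$1$1 - A$2$2" "b = A$1$2" "c = A$2$1"
  define p q r where pqr: "p = B$1$1 - B$2$2" "q = B$1$2" "r = B$2$1"
  define x y z where xyz: "x = Z$1$1 - Z$2$2" "y = Z$1$2" "z = Z$2$1"
  have k: "b * z = y * c" "a * y = b * x" "a * z = c * x"
      "q * z = y * r" "p * y = q * x" "p * z = r * x"
    using assms(2,3) by (simp_all add: commute_iff_2 abc pqr xyz)
  have "x \<noteq> 0 \<or> y \<noteq> 0 \<or> z \<noteq> 0" using False by (auto simp: xyz)
  \<comment> \<open>Each 2-by-2 minor of the triples of \<open>A\<close> and \<open>B\<close> is
    killed by all coordinates of \<open>Z\<close>, one of which is nonzero.\<close>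
  moreover have "x * (b * r - q * c) = 0" "x * (a * q - b * p) = 0" "x * (a * r - c * p) = 0"
      "y * (b * r - q * c) = 0" "y * (a * q - b * p) = 0" "y * (a * r - c * p) = 0"
      "z * (b * r - q * c) = 0" "z * (a * q - b * p) = 0" "z * (a * r - c * p) = 0"
    using k by algebra+
  ultimately have "b * r = q * c" "a * q = b * p" "a * r = c * p" by auto
  then show ?thesis by (simp add: commute_iff_2 abc pqr)
qed


section \<open>Braid relations in the modular group\<close>

text \<open>The coset of \<open>A\<close> modulo the subgroup of plus and minus the identity, hence
  an element of \<open>PSL2Z\<close> when \<open>A\<close> has determinant 1.\<close>

definition pm :: "int^2^2 \<Rightarrow> (int^2^2) set" where
  "pm A = {A, - A}"

lemma pm_eq_iff: "pm A = pm B \<longleftrightarrow> A = B \<or> A = - B"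
  by (auto simp: pm_def doubleton_eq_iff)

lemma pm_uminus: "pm (- A) = pm A"
  by (simp add: pm_eq_iff)

lemma pm_coset:
  "{mat 1, - mat 1} #>\<^bsub>SL2Z\<^esub> A = pm A"
  by (auto simp: r_coset_def SL2Z_def pm_def uminus_matrix_mult_2)

lemma carrier_PSL2Z: "carrier PSL2Z = pm ` {A. det A = 1}"
  by (simp add: PSL2Z_def carrier_FactGroup pm_coset) (simp add: SL2Z_def)

lemma one_PSL2Z: "\<one>\<^bsub>PSL2Z\<^esub> = pm (mat 1)"
  by (simp add: PSL2Z_def pm_def)

lemma mult_PSL2Z:
  assumes "det A = 1" "det B = 1"
  shows "pm A \<otimes>\<^bsub>PSL2Z\<^esub> pm B = pm (A ** B)"
  using normal.rcos_sum[OF normal_pm_one_SL2Z, of A B] assms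
  by (simp add: PSL2Z_def pm_coset) (simp add: SL2Z_def)

lemma PSL2Z_commute_lift:
  assumes "det A = 1" "det C = 1" "pm A \<otimes>\<^bsub>PSL2Z\<^esub> pm C = pm C \<otimes>\<^bsub>PSL2Z\<^esub> pm A"
  shows "A ** C = C ** A"
  using assms SL2_not_anticommute[OF assms(1,2)] by (auto simp: mult_PSL2Z pm_eq_iff)

text \<open>Replacing \<open>B\<close> by \<open>- B\<close> changes the sign of
  \<open>A B A\<close> but not of \<open>B A B\<close>, which repairs a wrong sign. The lift
  \<open>A\<close> stays untouched, so it can serve in two braid relations at once.\<close>

lemma PSL2Z_braid_lift:
  assumes "det A = 1" "b \<in> carrier PSL2Z"
    and "pm A \<otimes>\<^bsub>PSL2Z\<^esub> b \<otimes>\<^bsub>PSL2Z\<^esub> pm A = b \<otimes>\<^bsub>PSL2Z\<^esub> pm A \<otimes>\<^bsub>PSL2Z\<^esub> b"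
  obtains B where "det B = 1" "b = pm B" "A ** B ** A = B ** A ** B"
proof -
  obtain B where B: "det B = 1" "b = pm B"
    using assms(2) by (auto simp: carrier_PSL2Z)
  have "A ** B ** A = B ** A ** B \<or> A ** B ** A = - (B ** A ** B)"
    using assms B by (simp add: mult_PSL2Z det_mul pm_eq_iff)
  then show thesis
  proof
    assume "A ** B ** A = - (B ** A ** B)"
    then have "A ** (- B) ** A = (- B) ** A ** (- B)"
      by (simp add: uminus_matrix_mult_2)
    then show thesis using that[of "- B"] B by (simp add: det_uminus_2 pm_uminus)
  qed (use that B in blast)
qed

lemma PSL2Z_braid_commute_eq:
  assumes "a \<in> carrier PSL2Z" "b \<in> carrier PSL2Z" "c \<in> carrier PSL2Z"
    and ab: "a \<otimes>\<^bsub>PSL2Z\<^esub> b \<otimes>\<^bsub>PSL2Z\<^esub> a = b \<otimes>\<^bsub>PSL2Z\<^esub> a \<otimes>\<^bsub>PSL2Z\<^esub> b"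
    and bc: "b \<otimes>\<^bsub>PSL2Z\<^esub> c \<otimes>\<^bsub>PSL2Z\<^esub> b = c \<otimes>\<^bsub>PSL2Z\<^esub> b \<otimes>\<^bsub>PSL2Z\<^esub> c"
    and ac: "a \<otimes>\<^bsub>PSL2Z\<^esub> c = c \<otimes>\<^bsub>PSL2Z\<^esub> a"
  shows "a = c"
proof -
  interpret group PSL2Z by (rule group_PSL2Z)
  obtain B where B: "det B = 1" "b = pm B"
    using assms(2) by (auto simp: carrier_PSL2Z)
  \<comment> \<open>Both signs are adjusted against the same fixed lift \<open>B\<close> of the
    middle element.\<close>
  obtain A where A: "det A = 1" "a = pm A" "B ** A ** B = A ** B ** A"
    using PSL2Z_braid_lift[of B a] assms B by metis
  obtain C where C: "det C = 1" "c = pm C" "B ** C ** B = C ** B ** C"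
    using PSL2Z_braid_lift[of B c] assms B by metis
  \<comment> \<open>The trace of a product is known to be 1 only for distinct factors. If
    \<open>b\<close> equals \<open>a\<close> or \<open>c\<close>, then \<open>a\<close> and
    \<open>c\<close> themselves satisfy the braid relation and commute.\<close>
  consider "a = b" | "b = c" | "A \<noteq> B" "C \<noteq> B" using A B C by auto
  then show ?thesis
  proof cases
    case 1
    then show ?thesis using braid_commute_imp_eq[of a c] assms by simp
  next
    case 2
    then show ?thesis using braid_commute_imp_eq[of a c] assms by simp
  next
    case 3
    have "A ** C = C ** A"
      using PSL2Z_commute_lift[OF A(1) C(1)] ac A C by simp
    then have "A = C"
      using SL2_braid_trace[OF A(1) B(1)] SL2_braid_trace[OF C(1) B(1)] A C 3
        commuting_eq_if_traces[of A "trace B" B C] by metis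
    then show ?thesis using A C by simp
  qed
qed

lemma PSL2Z_braid_centralizer:
  assumes "a \<in> carrier PSL2Z" "b \<in> carrier PSL2Z" "z \<in> carrier PSL2Z"
    and ab: "a \<otimes>\<^bsub>PSL2Z\<^esub> b \<otimes>\<^bsub>PSL2Z\<^esub> a = b \<otimes>\<^bsub>PSL2Z\<^esub> a \<otimes>\<^bsub>PSL2Z\<^esub> b" and "a \<noteq> b"
    and az: "a \<otimes>\<^bsub>PSL2Z\<^esub> z = z \<otimes>\<^bsub>PSL2Z\<^esub> a" and bz: "b \<otimes>\<^bsub>PSL2Z\<^esub> z = z \<otimes>\<^bsub>PSL2Z\<^esub> b"
  shows "z = \<one>\<^bsub>PSL2Z\<^esub>"
proof -
  interpret group PSL2Z by (rule group_PSL2Z)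
  obtain A B Z where A: "det A = 1" "a = pm A" and B: "det B = 1" "b = pm B"
    and Z: "det Z = 1" "z = pm Z"
    using assms(1-3) by (auto simp: carrier_PSL2Z)
  have "A ** Z = Z ** A" "B ** Z = Z ** B"
    using PSL2Z_commute_lift A B Z az bz by auto
  then have "A ** B = B ** A \<or> Z = mat 1 \<or> Z = - mat 1"
    using commute_trans_or_scalar Z(1) by blast
  \<comment> \<open>Commuting lifts would make \<open>a\<close> and \<open>b\<close> commute, and
    then the braid relation would identify them.\<close>
  moreover have "A ** B \<noteq> B ** A"
    using braid_commute_imp_eq[OF assms(1,2) ab] \<open>a \<noteq> b\<close> A B by (metis mult_PSL2Z)
  ultimately show ?thesis using Z by (auto simp: one_PSL2Z pm_uminus)
qed


section \<open>Homomorphisms from braid groups to the modular group\<close>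

text \<open>The outer two of three consecutive generators commute, and each is braided with the
  middle one.\<close>

lemma artin_generator_image_shift_2:
  assumes "\<phi> \<in> hom (braid_group n) PSL2Z" "1 \<le> i" "i + 2 < n"
  shows "\<phi> (artin_generator n (i + 2)) = \<phi> (artin_generator n i)"
proof -
  have "\<phi> (artin_generator n j) \<in> carrier PSL2Z" if "j \<in> {1..<n}" for j
    using that assms(1) by (simp add: artin_generator_closed hom_in_carrier)
  moreover have "\<phi> (artin_generator n i) \<otimes>\<^bsub>PSL2Z\<^esub> \<phi> (artin_generator n (i + 2)) =
      \<phi> (artin_generator n (i + 2)) \<otimes>\<^bsub>PSL2Z\<^esub> \<phi> (artin_generator n i)"
    using hom_artin_generators_commute assms by blast
  ultimately show ?thesis
    using assms hom_artin_generators_braid[OF assms(1), of i] hom_artin_generators_braid[OF assms(1), of "i + 1"]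
      PSL2Z_braid_commute_eq[of "\<phi> (artin_generator n i)" "\<phi> (artin_generator n (i + 1))"
        "\<phi> (artin_generator n (i + 2))"]
    by simp
qed

lemma cyclic_hom_braid_group_5:
  assumes \<phi>: "\<phi> \<in> hom (braid_group n) PSL2Z" and n: "n \<ge> 5"
  shows "cyclic_hom (braid_group n) PSL2Z \<phi>"
proof (rule cyclic_hom_braid_groupI[OF group_PSL2Z \<phi>])
  interpret group PSL2Z by (rule group_PSL2Z)
  define s where "s i = \<phi> (artin_generator n i)" for i
  have cl: "s i \<in> carrier PSL2Z" if "i \<in> {1..<n}" for i
    using that \<phi> by (simp add: s_def artin_generator_closed hom_in_carrier)
  have s4: "s 4 = s 2"
    using artin_generator_image_shift_2[OF \<phi>, of 2] n by (simp add: s_def)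
  \<comment> \<open>Five strands provide a fourth generator: it commutes with the first but shares
    its image with the second.\<close>
  have "s 1 \<otimes>\<^bsub>PSL2Z\<^esub> s 4 = s 4 \<otimes>\<^bsub>PSL2Z\<^esub> s 1"
    unfolding s_def using hom_artin_generators_commute[OF \<phi>, of 1 4] n by simp
  moreover have "s 1 \<otimes>\<^bsub>PSL2Z\<^esub> s 2 \<otimes>\<^bsub>PSL2Z\<^esub> s 1 = s 2 \<otimes>\<^bsub>PSL2Z\<^esub> s 1 \<otimes>\<^bsub>PSL2Z\<^esub> s 2"
    unfolding s_def using hom_artin_generators_braid[OF \<phi>, of 1] n
    by (simp add: numeral_2_eq_2)
  ultimately have s2: "s 2 = s 1"
    using braid_commute_imp_eq[of "s 1" "s 2"] cl s4 n by simp
  show "\<phi> (artin_generator n i) = s 1" if "i \<in> {1..<n}" for i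
    using that unfolding s_def[symmetric]
  \<comment> \<open>Indices drop by two, so 1 and 2 are both base cases.\<close>
  proof (induction i rule: less_induct)
    case (less i)
    show ?case
    proof (cases "i \<le> 2")
      case True
      with less.prems have "i = 1 \<or> i = 2" by auto
      then show ?thesis using s2 by auto
    next
      case False
      then have "i - 2 \<in> {1..<n}" "i - 2 + 2 = i" "i - 2 < i" using less.prems by auto
      then show ?thesis
        using less.IH[of "i - 2"] less.prems artin_generator_image_shift_2[OF \<phi>, of "i - 2"]
        by (simp add: s_def)
    qed
  qed
qed (use n in simp)

lemma hom_braid_group_4_factors:
  assumes \<phi>: "\<phi> \<in> hom (braid_group 4) PSL2Z"
  shows "\<exists>\<psi> \<in> hom (braid_group 3) PSL2Z. \<forall>x \<in> carrier (braid_group 4). \<phi> x = \<psi> (R_star x)"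
proof -
  interpret group PSL2Z by (rule group_PSL2Z)
  define s where "s i = \<phi> (artin_generator 4 i)" for i
  have s: "s \<in> {1..<3} \<rightarrow> carrier PSL2Z"
    using \<phi> by (simp add: s_def Pi_iff hom_in_carrier artin_generator_closed)
  have s12: "s 1 \<otimes>\<^bsub>PSL2Z\<^esub> s 2 \<otimes>\<^bsub>PSL2Z\<^esub> s 1 = s 2 \<otimes>\<^bsub>PSL2Z\<^esub> s 1 \<otimes>\<^bsub>PSL2Z\<^esub> s 2"
    unfolding s_def using hom_artin_generators_braid[OF \<phi>, of 1]
    by (simp add: numeral_2_eq_2)
  have cl: "s 1 \<in> carrier PSL2Z" "s 2 \<in> carrier PSL2Z" using s by (auto simp: Pi_iff)
  \<comment> \<open>On three strands no two generators are far apart, so the single braid relation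
    is all there is to check.\<close>
  have "word_value PSL2Z s u = word_value PSL2Z s v" if uv: "(u, v) \<in> braid_relations 3" for u v
  proof -
    have "u = [(1, True), (2, True), (1, True)]" "v = [(2, True), (1, True), (2, True)]"
      using uv by (auto simp: braid_relations_def)
    then show ?thesis using s12 cl by (simp add: m_assoc)
  qed
  from presented_group_universal[OF s this]
  obtain \<psi> where \<psi>: "\<psi> \<in> hom (braid_group 3) PSL2Z"
    and \<psi>s: "\<And>i. i \<in> {1..<3} \<Longrightarrow> \<psi> (artin_generator 3 i) = s i"
    unfolding braid_group_def artin_generator_def braid_class_def by blast
  have R: "\<psi> \<circ> R_star \<in> hom (braid_group 4) PSL2Z"
    using R_star_epi by (intro Group.hom_compose[OF _ \<psi>]) (simp add: epi_def)
  have gen: "\<phi> (artin_generator 4 i) = (\<psi> \<circ> R_star) (artin_generator 4 i)" if "i \<in> {1..<4}" for i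
  proof -
    from that have "i = 1 \<or> i = 2 \<or> i = 3" by auto
    \<comment> \<open>\<open>R_star\<close> identifies the first and third generators, so their
      images under \<open>\<phi>\<close> must agree.\<close>
    moreover have "s 3 = s 1"
      using artin_generator_image_shift_2[OF \<phi>, of 1] by (simp add: s_def numeral_3_eq_3)
    ultimately show ?thesis
      using \<psi>s[of 1] \<psi>s[of 2] R_star_artin_generator by (auto simp: s_def)
  qed
  have "\<phi> x = (\<psi> \<circ> R_star) x" if "x \<in> carrier (braid_group 4)" for x
    using hom_presented_group_eqI \<phi> R gen that
    unfolding braid_group_def artin_generator_def braid_class_def by blast
  then show ?thesis using \<psi> by auto
qed

lemma hom_braid_group_3_kills_center:
  assumes \<phi>: "\<phi> \<in> hom (braid_group 3) PSL2Z" and nc: "\<not> cyclic_hom (braid_group 3) PSL2Z \<phi>"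
    and z: "z \<in> group_center (braid_group 3)"
  shows "\<phi> z = \<one>\<^bsub>PSL2Z\<^esub>"
proof -
  let ?a = "artin_generator 3 1" and ?b = "artin_generator 3 2"
  have cl: "?a \<in> carrier (braid_group 3)" "?b \<in> carrier (braid_group 3)" "z \<in> carrier (braid_group 3)"
    using z by (auto simp: group_center_def intro!: artin_generator_closed)
  have comm: "\<phi> x \<otimes>\<^bsub>PSL2Z\<^esub> \<phi> z = \<phi> z \<otimes>\<^bsub>PSL2Z\<^esub> \<phi> x" if "x \<in> carrier (braid_group 3)" for x
  proof -
    have "z \<otimes>\<^bsub>braid_group 3\<^esub> x = x \<otimes>\<^bsub>braid_group 3\<^esub> z"
      using z that by (auto simp: group_center_def)
    then show ?thesis using hom_mult[OF \<phi>] that cl(3) by metis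
  qed
  \<comment> \<open>Equal images of the two generators would make \<open>\<phi>\<close>
    cyclic.\<close>
  have "\<phi> ?a \<noteq> \<phi> ?b"
  proof
    assume eq: "\<phi> ?a = \<phi> ?b"
    have *: "\<phi> (artin_generator 3 i) = \<phi> ?a" if "i \<in> {1..<3}" for i
    proof -
      from that have "i = 1 \<or> i = 2" by auto
      then show ?thesis using eq by auto
    qed
    have "cyclic_hom (braid_group 3) PSL2Z \<phi>"
      by (rule cyclic_hom_braid_groupI[OF group_PSL2Z \<phi> _ *]) simp_all
    with nc show False ..
  qed
  moreover have "\<phi> ?a \<otimes>\<^bsub>PSL2Z\<^esub> \<phi> ?b \<otimes>\<^bsub>PSL2Z\<^esub> \<phi> ?a = \<phi> ?b \<otimes>\<^bsub>PSL2Z\<^esub> \<phi> ?a \<otimes>\<^bsub>PSL2Z\<^esub> \<phi> ?b"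
    using hom_artin_generators_braid[OF \<phi>, of 1] by (simp add: numeral_2_eq_2)
  ultimately show ?thesis
    using PSL2Z_braid_centralizer[OF cl[THEN hom_in_carrier[OF \<phi>]]] comm cl(1,2) by blast
qed

theorem theorem2p1:
  fixes n :: nat and \<phi> :: "nat word set \<Rightarrow> (int^2^2) set"
  assumes "\<phi> \<in> hom (braid_group n) PSL2Z"
  shows "(n \<ge> 5 \<longrightarrow> cyclic_hom (braid_group n) PSL2Z \<phi>) \<and>
    (n = 4 \<longrightarrow>
      (\<exists>\<psi> \<in> hom (braid_group 3) PSL2Z.
        \<forall>x \<in> carrier (braid_group 4). \<phi> x = \<psi> (R_star x))) \<and>
    (n = 3 \<and> \<not> cyclic_hom (braid_group n) PSL2Z \<phi> \<longrightarrow>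
      (let Z = group_center (braid_group 3) in
        (\<exists>\<psi> \<in> hom (braid_group 3 Mod Z) PSL2Z.
          \<forall>x \<in> carrier (braid_group 3). \<phi> x = \<psi> (Z #>\<^bsub>braid_group 3\<^esub> x)) \<and>
        (\<forall>\<theta> \<in> iso (braid_group 3 Mod Z) PSL2Z. \<exists>\<epsilon> \<in> hom PSL2Z PSL2Z.
          \<forall>x \<in> carrier (braid_group 3). \<phi> x = \<epsilon> (\<theta> (Z #>\<^bsub>braid_group 3\<^esub> x)))))"
proof (intro conjI impI)
  show "cyclic_hom (braid_group n) PSL2Z \<phi>" if "n \<ge> 5"
    using assms that by (rule cyclic_hom_braid_group_5)
  show "\<exists>\<psi> \<in> hom (braid_group 3) PSL2Z. \<forall>x \<in> carrier (braid_group 4). \<phi> x = \<psi> (R_star x)"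
    if "n = 4"
    using assms that by (intro hom_braid_group_4_factors) simp
next
  assume *: "n = 3 \<and> \<not> cyclic_hom (braid_group n) PSL2Z \<phi>"
  let ?B = "braid_group 3"
  define Z where "Z = group_center ?B"
  have \<phi>: "\<phi> \<in> hom ?B PSL2Z" using assms * by simp
  interpret \<phi>: group_hom ?B PSL2Z \<phi>
    using \<phi> group_braid_group group_PSL2Z by (simp add: group_hom_def group_hom_axioms_def)
  have Z: "Z \<lhd> ?B" unfolding Z_def by (rule \<phi>.G.normal_group_center)
  have "Z \<subseteq> kernel ?B PSL2Z \<phi>"
    using hom_braid_group_3_kills_center[OF \<phi>] * by (auto simp: kernel_def Z_def group_center_def)
  from \<phi>.FactGroup_universal_kernel[OF Z this]
  obtain \<psi> where \<psi>: "\<psi> \<in> hom (?B Mod Z) PSL2Z"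
      "\<And>x. x \<in> carrier ?B \<Longrightarrow> \<psi> (Z #>\<^bsub>?B\<^esub> x) = \<phi> x"
    by blast
  have "\<exists>\<epsilon> \<in> hom PSL2Z PSL2Z. \<forall>x \<in> carrier ?B. \<phi> x = \<epsilon> (\<theta> (Z #>\<^bsub>?B\<^esub> x))"
    if \<theta>: "\<theta> \<in> iso (?B Mod Z) PSL2Z" for \<theta>
  proof
    interpret BZ: group "?B Mod Z" by (rule normal.factorgroup_is_group[OF Z])
    \<comment> \<open>Inverting the given identification \<open>\<theta>\<close> carries the induced
      map \<open>\<psi>\<close> over to \<open>PSL2Z\<close>, whichever isomorphism was
      chosen.\<close>
    let ?\<eta> = "inv_into (carrier (?B Mod Z)) \<theta>"
    have "?\<eta> \<in> hom PSL2Z (?B Mod Z)"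
      using BZ.iso_set_sym[OF \<theta>] by (simp add: iso_def)
    then show "\<psi> \<circ> ?\<eta> \<in> hom PSL2Z PSL2Z" using \<psi>(1) by (rule Group.hom_compose)
    have "inj_on \<theta> (carrier (?B Mod Z))" using \<theta> by (simp add: iso_def bij_betw_def)
    then show "\<forall>x \<in> carrier ?B. \<phi> x = (\<psi> \<circ> ?\<eta>) (\<theta> (Z #>\<^bsub>?B\<^esub> x))"
      using \<psi>(2) by (simp add: carrier_FactGroup)
  qed
  then show "let Z = group_center ?B in
      (\<exists>\<psi> \<in> hom (?B Mod Z) PSL2Z. \<forall>x \<in> carrier ?B. \<phi> x = \<psi> (Z #>\<^bsub>?B\<^esub> x)) \<and>
      (\<forall>\<theta> \<in> iso (?B Mod Z) PSL2Z. \<exists>\<epsilon> \<in> hom PSL2Z PSL2Z.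
        \<forall>x \<in> carrier ?B. \<phi> x = \<epsilon> (\<theta> (Z #>\<^bsub>?B\<^esub> x)))"
    using \<psi> unfolding Let_def Z_def[symmetric] by (metis (no_types, lifting))
qed

end
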